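(* For each $n$, let $\mathbf p=\{p_{ij}\}_{1\le i<j\le n}$ and $\mathbf p'=\{p_{ij}'\}_{1\le i<j\le n}$ be random vectors of probabilities in $[0,1]$ (both may depend on $n$), and suppose that $p_{ij}'=p_{ij}+O(p_{ij}^2)$. (i) If $\sum_{1\le i<j\le n}p_{ij}^3=o_p(1)$, then $G(n,\mathbf p)\cong G(n,\mathbf p')$. (ii) If $\sum_{1\le i<j\le n}p_{ij}^3=O_p(1)$ and further, for some constant $c>0$, with high probability $\max_{i,j}p_{ij}\le0.9$, $\max_{i,j}p_{ij}'\le0.9$ and $p_{ij}'\ge c\,p_{ij}$ for all $i,j$, then $G(n,\mathbf p)$ and $G(n,\mathbf p')$ are mutually contiguous, that is, $G(n,\mathbf p)\vartriangleleft G(n,\mathbf p')$ and $G(n,\mathbf p')\vartriangleleft G(n,\mathbf p)$.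
   Context: Random graph model: if $\mathbf p=\{p_{ij}\}_{1\le i<j\le n}$ is a random vector with entries in $[0,1]$, then $G(n,\mathbf p)$ is the random graph with vertex set $\{1,\dots,n\}$ such that, conditionally on $\mathbf p$, the indicators $I_{ij}$ of the events that edge $ij$ is present ($1\le i<j\le n$) are independent and $I_{ij}$ equals $1$ with probability $p_{ij}$. For each $n$, $\mathbf p$ and $\mathbf p'$ are defined on a common probability space. Conventions: all limits are as $n\to\infty$; "with high probability" means with probability tending to $1$ as $n\to\infty$. The hypothesis $p_{ij}'=p_{ij}+O(p_{ij}^2)$ means that there is a (deterministic) constant $K$, independent of $n,i,j$, with $|p_{ij}'-p_{ij}|\le Kp_{ij}^2$ for all $n$ and $1\le i<j\le n$. For nonnegative random quantities $S_n$: $S_n=o_p(1)$ means $S_n\to0$ in probability; $S_n=O_p(1)$ means that for every $\varepsilon>0$ there exists $C$ such that $\mathbb P(S_n>C)<\varepsilon$ for all $n$. Asymptotic equivalence and contiguity: for random graphs $G_n,G_n'$ on $\{1,\dots,n\}$, $G_n\cong G_n'$ (asymptotically equivalent) means $\mathbb P(G_n\in A_n)-\mathbb P(G_n'\in A_n)\to0$ for every sequence of sets $A_n$ of graphs on $\{1,\dots,n\}$. $G_n\vartriangleleft G_n'$ ($G_n$ is contiguous with respect to $G_n'$) means that for every sequence of sets $A_n$ of graphs on $\{1,\dots,n\}$ with $\mathbb P(G_n'\in A_n)\to0$ one has $\mathbb P(G_n\in A_n)\to0$. *)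

theory Defs
  imports "HOL-Probability.Probability"
begin

definition vertex_pairs :: "nat \<Rightarrow> (nat \<times> nat) set" where
  "vertex_pairs n = {(i, j). 1 \<le> i \<and> i < j \<and> j \<le> n}"

text \<open>A graph on the vertex set \<open>{1..n}\<close> is identified with its set of edges.\<close>

definition graphs :: "nat \<Rightarrow> nat set set set" where
  "graphs n = Pow ((\<lambda>(i, j). {i, j}) ` vertex_pairs n)"

definition random_probability_vector ::
    "nat \<Rightarrow> 'a measure \<Rightarrow> ('a \<Rightarrow> nat \<Rightarrow> nat \<Rightarrow> real) \<Rightarrow> bool" where
  "random_probability_vector n M p \<longleftrightarrow>
     (\<forall>(i, j) \<in> vertex_pairs n.
        (\<lambda>\<omega>. p \<omega> i j) \<in> borel_measurable M \<and> (\<forall>\<omega> \<in> space M. p \<omega> i j \<in> {0..1}))"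

definition edge_set :: "nat \<Rightarrow> (nat \<times> nat \<Rightarrow> bool) \<Rightarrow> nat set set" where
  "edge_set n I = (\<lambda>(i, j). {i, j}) ` {e \<in> vertex_pairs n. I e}"

text \<open>The law of \<open>G(n, q)\<close> for a deterministic \<open>q\<close>: independent edge indicators, the one of
  \<open>{i, j}\<close> (\<open>i < j\<close>) being Bernoulli with parameter \<open>q i j\<close>.\<close>

definition graph_pmf :: "nat \<Rightarrow> (nat \<Rightarrow> nat \<Rightarrow> real) \<Rightarrow> nat set set pmf" where
  "graph_pmf n q =
     map_pmf (edge_set n) (Pi_pmf (vertex_pairs n) False (\<lambda>(i, j). bernoulli_pmf (q i j)))"

text \<open>The law of \<open>G(n, p)\<close> for a random vector \<open>p\<close> on \<open>M\<close>: first draw \<open>\<omega>\<close> from \<open>M\<close>, then draw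
  the graph from \<open>graph_pmf n (p \<omega>)\<close>, which is thus its conditional law given \<open>p\<close>. The kernel is
  measurable by \<open>measurable_graph_pmf\<close> below, so that the monadic bind is meaningful.\<close>

definition random_graph ::
    "nat \<Rightarrow> 'a measure \<Rightarrow> ('a \<Rightarrow> nat \<Rightarrow> nat \<Rightarrow> real) \<Rightarrow> nat set set measure" where
  "random_graph n M p = M \<bind> (\<lambda>\<omega>. measure_pmf (graph_pmf n (p \<omega>)))"

text \<open>Both relations depend on the random graphs only through their laws \<open>\<mu> n\<close> and \<open>\<nu> n\<close>.\<close>

definition asymptotically_equivalent ::
    "(nat \<Rightarrow> nat set set measure) \<Rightarrow> (nat \<Rightarrow> nat set set measure) \<Rightarrow> bool" where
  "asymptotically_equivalent \<mu> \<nu> \<longleftrightarrow>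
     (\<forall>A. (\<forall>n. A n \<subseteq> graphs n) \<longrightarrow>
        (\<lambda>n. measure (\<mu> n) (A n) - measure (\<nu> n) (A n)) \<longlonglongrightarrow> 0)"

definition contiguous ::
    "(nat \<Rightarrow> nat set set measure) \<Rightarrow> (nat \<Rightarrow> nat set set measure) \<Rightarrow> bool" where
  "contiguous \<mu> \<nu> \<longleftrightarrow>
     (\<forall>A. (\<forall>n. A n \<subseteq> graphs n) \<longrightarrow>
        (\<lambda>n. measure (\<nu> n) (A n)) \<longlonglongrightarrow> 0 \<longrightarrow> (\<lambda>n. measure (\<mu> n) (A n)) \<longlonglongrightarrow> 0)"

definition whp :: "(nat \<Rightarrow> 'a measure) \<Rightarrow> (nat \<Rightarrow> 'a \<Rightarrow> bool) \<Rightarrow> bool" where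
  "whp M P \<longleftrightarrow> (\<lambda>n. \<P>(\<omega> in M n. P n \<omega>)) \<longlonglongrightarrow> 1"

text \<open>\<open>S n = o\<^sub>p(1)\<close> and \<open>S n = O\<^sub>p(1)\<close> for nonnegative random variables \<open>S n\<close> on \<open>M n\<close>.\<close>

definition little_op_one :: "(nat \<Rightarrow> 'a measure) \<Rightarrow> (nat \<Rightarrow> 'a \<Rightarrow> real) \<Rightarrow> bool" where
  "little_op_one M S \<longleftrightarrow> (\<forall>\<epsilon>>0. (\<lambda>n. \<P>(\<omega> in M n. S n \<omega> > \<epsilon>)) \<longlonglongrightarrow> 0)"

definition big_op_one :: "(nat \<Rightarrow> 'a measure) \<Rightarrow> (nat \<Rightarrow> 'a \<Rightarrow> real) \<Rightarrow> bool" where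
  "big_op_one M S \<longleftrightarrow> (\<forall>\<epsilon>>0. \<exists>C. \<forall>n. \<P>(\<omega> in M n. S n \<omega> > C) < \<epsilon>)"

lemma finite_vertex_pairs [simp]: "finite (vertex_pairs n)"
  by (rule finite_subset[of _ "{1..n} \<times> {1..n}"]) (auto simp: vertex_pairs_def)

lemma edge_set_in_graphs: "edge_set n I \<in> graphs n"
  by (auto simp: edge_set_def graphs_def)

lemma measure_graph_pmf:
  "measure (graph_pmf n q) A =
     (\<Sum>I | I \<in> PiE_dflt (vertex_pairs n) False (\<lambda>_. UNIV) \<and> edge_set n I \<in> A.
        \<Prod>(i, j)\<in>vertex_pairs n. pmf (bernoulli_pmf (q i j)) (I (i, j)))"
proof -
  let ?P = "Pi_pmf (vertex_pairs n) False (\<lambda>(i, j). bernoulli_pmf (q i j))"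
  let ?D = "PiE_dflt (vertex_pairs n) False (\<lambda>_. UNIV) :: (nat \<times> nat \<Rightarrow> bool) set"
  have fin: "finite {I. I \<in> ?D \<and> edge_set n I \<in> A}"
    using finite_PiE_dflt[of "vertex_pairs n" "\<lambda>_. UNIV :: bool set" False] by simp
  have "measure (graph_pmf n q) A = measure ?P (edge_set n -` A)"
    by (simp add: graph_pmf_def)
  also have "\<dots> = measure ?P {I. I \<in> ?D \<and> edge_set n I \<in> A}"
  proof (intro measure_pmf.finite_measure_eq_AE)
    have "set_pmf ?P \<subseteq> ?D"
      using set_Pi_pmf_subset[OF finite_vertex_pairs, of n False "\<lambda>(i, j). bernoulli_pmf (q i j)"]
      by (auto simp: PiE_dflt_def)
    then show "AE I in ?P. (I \<in> edge_set n -` A) = (I \<in> {I. I \<in> ?D \<and> edge_set n I \<in> A})"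
      by (intro AE_pmfI) auto
  qed auto
  also have "\<dots> = (\<Sum>I | I \<in> ?D \<and> edge_set n I \<in> A. pmf ?P I)"
    by (rule measure_measure_pmf_finite[OF fin])
  also have "\<dots> = (\<Sum>I | I \<in> ?D \<and> edge_set n I \<in> A.
      \<Prod>(i, j)\<in>vertex_pairs n. pmf (bernoulli_pmf (q i j)) (I (i, j)))"
    by (intro sum.cong refl, subst pmf_Pi') (auto simp: PiE_dflt_def intro!: prod.cong)
  finally show ?thesis .
qed

lemma measurable_graph_pmf:
  assumes "random_probability_vector n M p"
  shows "(\<lambda>\<omega>. measure_pmf (graph_pmf n (p \<omega>))) \<in> measurable M (prob_algebra (count_space UNIV))"
proof (rule measurable_prob_algebraI)
  show "prob_space (measure_pmf (graph_pmf n (p \<omega>)))" for \<omega>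
    by (rule prob_space_measure_pmf)
next
  have pm: "(\<lambda>\<omega>. pmf (bernoulli_pmf (p \<omega> i j)) b) \<in> borel_measurable M"
    if "(i, j) \<in> vertex_pairs n" for i j b
  proof -
    have [measurable]: "(\<lambda>\<omega>. p \<omega> i j) \<in> borel_measurable M"
      and rng: "\<forall>\<omega>\<in>space M. p \<omega> i j \<in> {0..1}"
      using assms that by (auto simp: random_probability_vector_def)
    have "(\<lambda>\<omega>. if b then p \<omega> i j else 1 - p \<omega> i j) \<in> borel_measurable M"
      by measurable
    also have "?this \<longleftrightarrow> ?thesis"
      using rng by (intro measurable_cong) (cases b; auto)
    finally show ?thesis .
  qed
  show "(\<lambda>\<omega>. measure_pmf (graph_pmf n (p \<omega>))) \<in> measurable M (subprob_algebra (count_space UNIV))"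
  proof (rule measurable_subprob_algebra)
    show "subprob_space (measure_pmf (graph_pmf n (p \<omega>)))" for \<omega>
      by (rule measure_pmf.subprob_space_axioms)
    show "sets (measure_pmf (graph_pmf n (p \<omega>))) = sets (count_space UNIV)" for \<omega>
      by simp
    fix A :: "nat set set set"
    show "(\<lambda>\<omega>. emeasure (measure_pmf (graph_pmf n (p \<omega>))) A) \<in> borel_measurable M"
      unfolding measure_pmf.emeasure_eq_measure measure_graph_pmf
      by (intro measurable_compose[OF _ measurable_ennreal] borel_measurable_sum
          borel_measurable_prod) (auto intro: pm)
  qed
qed

lemma prob_space_random_graph:
  assumes "prob_space M" "random_probability_vector n M p"
  shows "prob_space (random_graph n M p)" "sets (random_graph n M p) = UNIV"
proof -
  have M: "M \<in> space (prob_algebra M)"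
    using assms(1) by (simp add: space_prob_algebra)
  show "prob_space (random_graph n M p)"
    unfolding random_graph_def by (rule prob_space_bind'[OF M measurable_graph_pmf[OF assms(2)]])
  show "sets (random_graph n M p) = UNIV"
    unfolding random_graph_def
    using sets_bind'[OF M measurable_graph_pmf[OF assms(2)]] by simp
qed

lemma measure_random_graph:
  assumes "prob_space M" "random_probability_vector n M p"
  shows "measure (random_graph n M p) A = (\<integral>\<omega>. measure (graph_pmf n (p \<omega>)) A \<partial>M)"
proof -
  interpret prob_space M by (rule assms)
  show ?thesis
    unfolding random_graph_def
    by (rule measure_bind[OF measurable_prob_algebraD[OF measurable_graph_pmf[OF assms(2)]]]) simp
qed

end

theory Submission
  imports Defs
begin

text \<open>Condition on the two vectors. The likelihood ratio of the two edge indicators of \<open>ij\<close> has second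
  moment \<open>1 + O(p\<^sub>i\<^sub>j\<^sup>3)\<close>, because \<open>(p' - p)\<^sup>2 / (p (1 - p)) = O(p\<^sup>3)\<close>; second moments
  multiply over independent edges, so the second moment \<open>D\<close> of the likelihood ratio of the two graphs is at
  most \<open>exp (O(\<Sum> p\<^sub>i\<^sub>j\<^sup>3))\<close>. A sum of cubes tending to \<open>0\<close> makes \<open>D - 1\<close>, and with it the total
  variation distance, tend to \<open>0\<close>; a bounded sum of cubes makes \<open>D\<close> bounded. The resulting comparisons of
  probabilities are stated linearly (AM-GM with a free parameter instead of Cauchy-Schwarz), so that
  they survive averaging over the random vectors.\<close>

section \<open>Comparison of two weights on a finite set through a second moment\<close>

text \<open>AM-GM applied to \<open>g x = sqrt (t * f x) * (g x / sqrt (t * f x))\<close> gives the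
  bound pointwise, with a factor 1/2 given away. The terms of the second moment are nonnegative, so
  their sum may be enlarged from \<open>A\<close> to \<open>X\<close>.\<close>

lemma sum_le_second_moment:
  fixes f g :: "'b \<Rightarrow> real"
  assumes "finite X" "A \<subseteq> X" "t > 0"
    and nonneg: "\<And>x. x \<in> X \<Longrightarrow> f x \<ge> 0"
    and ac: "\<And>x. x \<in> X \<Longrightarrow> f x = 0 \<Longrightarrow> g x = 0"
  shows "sum g A \<le> t * sum f A + (\<Sum>x\<in>X. (g x)\<^sup>2 / f x) / t"
proof -
  have pt: "g x \<le> t * f x + (g x)\<^sup>2 / f x / t" if "x \<in> X" for x
  proof (cases "f x = 0")
    case False
    then have "f x > 0" using nonneg[OF that] by simp
    moreover have "g x * (t * f x) \<le> (t * f x)\<^sup>2 + (g x)\<^sup>2"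
      using sum_squares_bound[of "g x" "t * f x"] sum_power2_ge_zero[of "g x" "t * f x"] by linarith
    ultimately show ?thesis
      using \<open>t > 0\<close> by (simp add: field_simps power2_eq_square)
  \<comment> \<open>At a zero of \<open>f\<close> absolute continuity makes \<open>g\<close> vanish
    too; since division by zero yields zero, both sides are then zero.\<close>
  qed (use ac that in auto)
  have "sum g A \<le> (\<Sum>x\<in>A. t * f x + (g x)\<^sup>2 / f x / t)"
    using pt \<open>A \<subseteq> X\<close> by (intro sum_mono) auto
  also have "\<dots> = t * sum f A + (\<Sum>x\<in>A. (g x)\<^sup>2 / f x) / t"
    by (simp add: sum.distrib sum_distrib_left sum_divide_distrib)
  also have "(\<Sum>x\<in>A. (g x)\<^sup>2 / f x) \<le> (\<Sum>x\<in>X. (g x)\<^sup>2 / f x)"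
    using assms by (intro sum_mono2) auto
  finally show ?thesis
    using \<open>t > 0\<close> by (simp add: divide_right_mono)
qed

text \<open>The same AM-GM argument applied to \<open>g - f\<close>. Expanding
  \<open>(g - f)^2 / f\<close> and using that both total masses are 1 turns its sum into the second
  moment minus 1, which is small when the likelihood ratio is close to 1.\<close>

lemma abs_sum_diff_le_second_moment:
  fixes f g :: "'b \<Rightarrow> real"
  assumes "finite X" "A \<subseteq> X" "t > 0"
    and nonneg: "\<And>x. x \<in> X \<Longrightarrow> f x \<ge> 0"
    and ac: "\<And>x. x \<in> X \<Longrightarrow> f x = 0 \<Longrightarrow> g x = 0"
    and total: "sum f X = 1" "sum g X = 1"
  shows "\<bar>sum g A - sum f A\<bar> \<le> t + ((\<Sum>x\<in>X. (g x)\<^sup>2 / f x) - 1) / t"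
proof -
  have pt: "\<bar>g x - f x\<bar> \<le> t * f x + ((g x)\<^sup>2 / f x - 2 * g x + f x) / t" if "x \<in> X" for x
  proof (cases "f x = 0")
    case False
    then have pos: "f x > 0" using nonneg[OF that] by simp
    have "\<bar>g x - f x\<bar> * (t * f x) \<le> (t * f x)\<^sup>2 + \<bar>g x - f x\<bar>\<^sup>2"
      using sum_squares_bound[of "\<bar>g x - f x\<bar>" "t * f x"]
        sum_power2_ge_zero[of "\<bar>g x - f x\<bar>" "t * f x"] by linarith
    then have "\<bar>g x - f x\<bar> \<le> t * f x + (g x - f x)\<^sup>2 / f x / t"
      using \<open>t > 0\<close> pos by (simp add: field_simps power2_eq_square)
    also have "(g x - f x)\<^sup>2 / f x = (g x)\<^sup>2 / f x - 2 * g x + f x"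
      using pos by (simp add: field_simps power2_eq_square)
    finally show ?thesis .
  qed (use ac that in auto)
  have "\<bar>sum g A - sum f A\<bar> \<le> (\<Sum>x\<in>A. \<bar>g x - f x\<bar>)"
    by (metis sum_abs sum_subtractf)
  also have "\<dots> \<le> (\<Sum>x\<in>X. \<bar>g x - f x\<bar>)"
    using assms by (intro sum_mono2) auto
  also have "\<dots> \<le> (\<Sum>x\<in>X. t * f x + ((g x)\<^sup>2 / f x - 2 * g x + f x) / t)"
    using pt by (intro sum_mono)
  also have "\<dots> = t * sum f X + ((\<Sum>x\<in>X. (g x)\<^sup>2 / f x) - 2 * sum g X + sum f X) / t"
    by (simp add: sum.distrib sum_subtractf sum_distrib_left flip: sum_divide_distrib)
  finally show ?thesis
    by (simp add: total)
qed

section \<open>The second moment for independent edges\<close>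

text \<open>This distributive law is what makes second moments multiply over independent edges. The
  values of \<open>h\<close> off \<open>A\<close> do not enter the product, so the default
  \<open>d\<close> may be exchanged for \<open>undefined\<close> and the law for \<open>PiE\<close>
  applies.\<close>

lemma sum_prod_PiE_dflt:
  fixes g :: "'b \<Rightarrow> 'c \<Rightarrow> 'd :: comm_semiring_1"
  assumes "finite A" "\<And>x. x \<in> A \<Longrightarrow> finite (B x)"
  shows "(\<Sum>h\<in>PiE_dflt A d B. \<Prod>x\<in>A. g x (h x)) = (\<Prod>x\<in>A. \<Sum>y\<in>B x. g x y)"
proof -
  have "(\<Sum>h\<in>PiE_dflt A d B. \<Prod>x\<in>A. g x (h x)) = (\<Sum>h\<in>PiE A B. \<Prod>x\<in>A. g x (h x))"
    by (rule sum.reindex_bij_witness[where i = "\<lambda>h x. if x \<in> A then h x else d"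
          and j = "\<lambda>h. restrict h A"])
      (auto simp: PiE_dflt_def fun_eq_iff PiE_def extensional_def)
  also have "\<dots> = (\<Prod>x\<in>A. \<Sum>y\<in>B x. g x y)"
    using assms by (rule prod_sum_PiE[symmetric])
  finally show ?thesis .
qed

text \<open>The second moment is exactly \<open>1 + (b - a)^2 / (a * (1 - a))\<close>. The scale
  \<open>x\<close> is kept apart from \<open>a\<close>: the error and the cubes are always measured
  in the entry of \<open>p\<close>, whereas \<open>a\<close> may be the entry of \<open>p\<close> or
  of \<open>p'\<close>.\<close>

lemma bernoulli_second_moment:
  fixes a b x c K :: real
  assumes "a \<in> {0..1}" "b \<in> {0..1}" "x \<ge> 0" "c > 0"
    and "\<bar>b - a\<bar> \<le> K * x\<^sup>2" "c * x \<le> a" "a \<le> 0.9"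
  shows "(\<Sum>y\<in>UNIV. (pmf (bernoulli_pmf b) y)\<^sup>2 / pmf (bernoulli_pmf a) y) \<le> 1 + 10 * K\<^sup>2 / c * x ^ 3"
    and "pmf (bernoulli_pmf a) y = 0 \<Longrightarrow> pmf (bernoulli_pmf b) y = 0"
proof -
  \<comment> \<open>\<open>c * x <= a\<close> forces \<open>x = 0\<close>, and then the error bound
    \<open>K * x^2\<close> forces \<open>b = a\<close>.\<close>
  have x0: "x = 0" and b0: "b = 0" if "a = 0"
  proof -
    show "x = 0"
      using assms that by (simp add: mult_le_0_iff)
    then show "b = 0"
      using assms that by simp
  qed
  show "pmf (bernoulli_pmf a) y = 0 \<Longrightarrow> pmf (bernoulli_pmf b) y = 0"
    using assms b0 by (cases y) auto
  show "(\<Sum>y\<in>UNIV. (pmf (bernoulli_pmf b) y)\<^sup>2 / pmf (bernoulli_pmf a) y) \<le> 1 + 10 * K\<^sup>2 / c * x ^ 3"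
  proof (cases "a = 0")
    case True
    then show ?thesis
      using x0 b0 by (simp add: UNIV_bool)
  next
    case False
    then have a: "a > 0" "1 - a \<ge> 1 / 10" "1 - a > 0"
      using assms by auto
    have "(b - a)\<^sup>2 \<le> (K * x\<^sup>2)\<^sup>2"
      using assms(5) by (metis abs_ge_zero power2_abs power_mono)
    \<comment> \<open>The power \<open>x^4\<close> is split so that one factor \<open>x\<close> pays
      for the denominator: \<open>c * x <= a\<close> and \<open>1/10 <= 1 - a\<close>. This is the
      source of the constant \<open>10 / c\<close>.\<close>
    also have "\<dots> = (10 * K\<^sup>2 / c * x ^ 3) * (c * x * (1 / 10))"
      using \<open>c > 0\<close> by (simp add: field_simps power2_eq_square power3_eq_cube)
    also have "\<dots> \<le> (10 * K\<^sup>2 / c * x ^ 3) * (a * (1 - a))"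
      using assms a by (intro mult_left_mono mult_mono) auto
    finally have "(b - a)\<^sup>2 / (a * (1 - a)) \<le> 10 * K\<^sup>2 / c * x ^ 3"
      using a by (simp add: pos_divide_le_eq)
    moreover have "b\<^sup>2 / a + (1 - b)\<^sup>2 / (1 - a) = 1 + (b - a)\<^sup>2 / (a * (1 - a))"
      using a by (simp add: divide_simps) (simp add: algebra_simps power2_eq_square)
    ultimately show ?thesis
      using assms by (simp add: UNIV_bool)
  qed
qed

text \<open>Both graph laws are images of product measures on edge indicators, so the two finite
  comparisons apply with a second moment that factors over the edges and is at most the exponential
  of a multiple of the sum of cubes.\<close>

lemma graph_pmf_comparison:
  assumes "t > 0" "c > 0"
    and edge: "\<And>i j. (i, j) \<in> vertex_pairs n \<Longrightarrow>
      q i j \<in> {0..1} \<and> q' i j \<in> {0..1} \<and> x i j \<ge> 0 \<and>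
      \<bar>q' i j - q i j\<bar> \<le> K * (x i j)\<^sup>2 \<and> c * x i j \<le> q i j \<and> q i j \<le> 0.9"
    and cubes: "(\<Sum>(i, j)\<in>vertex_pairs n. x i j ^ 3) \<le> C"
  shows "measure (graph_pmf n q') A \<le> t * measure (graph_pmf n q) A + exp (10 * K\<^sup>2 / c * C) / t"
    and "\<bar>measure (graph_pmf n q') A - measure (graph_pmf n q) A\<bar>
           \<le> t + (exp (10 * K\<^sup>2 / c * C) - 1) / t"
proof -
  let ?V = "vertex_pairs n"
  \<comment> \<open>Indicator functions that are \<open>False\<close> off the vertex pairs; fixing
    this default makes the space finite.\<close>
  define X :: "(nat \<times> nat \<Rightarrow> bool) set" where "X = PiE_dflt ?V False (\<lambda>_. UNIV)"
  define w where "w r e b = pmf (bernoulli_pmf (case e of (i, j) \<Rightarrow> r i j)) b"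
    for r :: "nat \<Rightarrow> nat \<Rightarrow> real" and e b
  define W where "W r I = (\<Prod>e\<in>?V. w r e (I e))" for r I
  define S where "S = {I \<in> X. edge_set n I \<in> A}"
  have fin: "finite X" and "S \<subseteq> X"
    using finite_PiE_dflt[of ?V "\<lambda>_. UNIV :: bool set" False] by (auto simp: X_def S_def)
  have meas: "measure (graph_pmf n r) A = sum (W r) S" for r
    unfolding measure_graph_pmf S_def X_def W_def w_def by (simp add: case_prod_unfold)
  have total: "sum (W r) X = 1" for r
  proof -
    have "sum (W r) X = (\<Prod>e\<in>?V. \<Sum>b\<in>UNIV. w r e b)"
      unfolding W_def X_def by (rule sum_prod_PiE_dflt) auto
    also have "\<dots> = 1"
      unfolding w_def by (simp add: sum_pmf_eq_1)
    finally show ?thesis .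
  qed
  have nonneg: "W q I \<ge> 0" for I
    by (auto simp: W_def w_def intro!: prod_nonneg)
  \<comment> \<open>A vanishing product has a vanishing factor, so absolute continuity is inherited
    from a single edge.\<close>
  have ac: "W q' I = 0" if null: "W q I = 0" for I
  proof -
    obtain i j where e: "(i, j) \<in> ?V" and "w q (i, j) (I (i, j)) = 0"
      using null by (auto simp: W_def)
    then have "w q' (i, j) (I (i, j)) = 0"
      using edge[OF e] bernoulli_second_moment(2)[OF _ _ _ \<open>c > 0\<close>, of "q i j" "q' i j" "x i j" K]
      by (simp add: w_def)
    then show ?thesis
      using e by (auto simp: W_def)
  qed
  have "(\<Sum>I\<in>X. (W q' I)\<^sup>2 / W q I) = (\<Sum>I\<in>X. \<Prod>e\<in>?V. (w q' e (I e))\<^sup>2 / w q e (I e))"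
    by (simp add: W_def prod_dividef prod_power_distrib)
  also have "\<dots> = (\<Prod>e\<in>?V. \<Sum>b\<in>UNIV. (w q' e b)\<^sup>2 / w q e b)"
    unfolding X_def by (rule sum_prod_PiE_dflt) auto
  also have "\<dots> \<le> (\<Prod>e\<in>?V. exp (10 * K\<^sup>2 / c * (case e of (i, j) \<Rightarrow> x i j ^ 3)))"
  proof (rule prod_mono, safe)
    fix i j assume e: "(i, j) \<in> ?V"
    show "0 \<le> (\<Sum>b\<in>UNIV. (w q' (i, j) b)\<^sup>2 / w q (i, j) b)"
      by (auto simp: w_def intro!: sum_nonneg)
    have "(\<Sum>b\<in>UNIV. (w q' (i, j) b)\<^sup>2 / w q (i, j) b) \<le> 1 + 10 * K\<^sup>2 / c * x i j ^ 3"
      unfolding w_def prod.case using edge[OF e] \<open>c > 0\<close> by (intro bernoulli_second_moment(1)) auto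
    \<comment> \<open>Passing from \<open>1 + u\<close> to \<open>exp u\<close> turns the product
      over edges into the exponential of a sum.\<close>
    also have "\<dots> \<le> exp (10 * K\<^sup>2 / c * x i j ^ 3)"
      by (rule exp_ge_add_one_self)
    finally show "(\<Sum>b\<in>UNIV. (w q' (i, j) b)\<^sup>2 / w q (i, j) b) \<le> exp (10 * K\<^sup>2 / c * x i j ^ 3)" .
  qed
  also have "\<dots> = exp (10 * K\<^sup>2 / c * (\<Sum>(i, j)\<in>?V. x i j ^ 3))"
    by (simp add: exp_sum sum_distrib_left)
  also have "\<dots> \<le> exp (10 * K\<^sup>2 / c * C)"
    using mult_left_mono[OF cubes, of "10 * K\<^sup>2 / c"] \<open>c > 0\<close> by simp
  finally have D: "(\<Sum>I\<in>X. (W q' I)\<^sup>2 / W q I) \<le> exp (10 * K\<^sup>2 / c * C)" .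
  show "measure (graph_pmf n q') A \<le> t * measure (graph_pmf n q) A + exp (10 * K\<^sup>2 / c * C) / t"
    using sum_le_second_moment[OF fin \<open>S \<subseteq> X\<close> \<open>t > 0\<close>, of "W q" "W q'"] nonneg ac
      divide_right_mono[OF D, of t] \<open>t > 0\<close> by (simp add: meas)
  show "\<bar>measure (graph_pmf n q') A - measure (graph_pmf n q) A\<bar>
      \<le> t + (exp (10 * K\<^sup>2 / c * C) - 1) / t"
    using abs_sum_diff_le_second_moment[OF fin \<open>S \<subseteq> X\<close> \<open>t > 0\<close>, of "W q" "W q'"] nonneg ac total
      divide_right_mono[OF diff_right_mono[OF D, of 1], of t] \<open>t > 0\<close> by (simp add: meas)
qed

section \<open>Averaging over the random vectors\<close>

lemma integrable_measure_graph_pmf: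
  assumes "prob_space M" "random_probability_vector n M p"
  shows "integrable M (\<lambda>\<omega>. measure (graph_pmf n (p \<omega>)) A)"
proof -
  interpret prob_space M by fact
  have "(\<lambda>\<omega>. emeasure (measure_pmf (graph_pmf n (p \<omega>))) A) \<in> borel_measurable M"
    by (rule measurable_emeasure_kernel[OF measurable_prob_algebraD[OF measurable_graph_pmf[OF assms(2)]]])
      simp
  then have "(\<lambda>\<omega>. measure (graph_pmf n (p \<omega>)) A) \<in> borel_measurable M"
    unfolding measure_def by measurable
  then show ?thesis
    by (intro integrable_const_bound[where B = 1]) auto
qed

text \<open>On \<open>B\<close> the bound \<open>f <= 1\<close> takes over, so
  \<open>f <= t * g + d + indicator B\<close> holds almost everywhere and can be integrated.
  Linearity in \<open>g\<close> is what lets the conditional comparison pass to the mean.\<close>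

lemma (in prob_space) integral_le_off_exceptional_set:
  fixes f g :: "'a \<Rightarrow> real"
  assumes "integrable M f" "integrable M g" "B \<in> events" "t \<ge> 0" "d \<ge> 0"
    and "\<And>\<omega>. f \<omega> \<le> 1" "\<And>\<omega>. g \<omega> \<ge> 0"
    and "AE \<omega> in M. \<omega> \<notin> B \<longrightarrow> f \<omega> \<le> t * g \<omega> + d"
  shows "(\<integral>\<omega>. f \<omega> \<partial>M) \<le> t * (\<integral>\<omega>. g \<omega> \<partial>M) + d + prob B"
proof -
  have "integrable M (indicat_real B)"
    using assms(3) by (intro integrable_real_indicator) (auto simp: less_top[symmetric])
  note int = this assms(1,2)
  have "(\<integral>\<omega>. f \<omega> \<partial>M) \<le> (\<integral>\<omega>. t * g \<omega> + d + indicator B \<omega> \<partial>M)"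
  proof (rule integral_mono_AE)
    show "integrable M (\<lambda>\<omega>. t * g \<omega> + d + indicator B \<omega>)"
      using int by (intro Bochner_Integration.integrable_add integrable_mult_right) auto
    show "AE \<omega> in M. f \<omega> \<le> t * g \<omega> + d + indicator B \<omega>"
      using assms(8)
    proof eventually_elim
      case (elim \<omega>)
      have "0 \<le> t * g \<omega>" using assms by simp
      with elim assms(5) assms(6)[of \<omega>] show ?case
        by (auto simp: indicator_def)
    qed
  qed fact
  also have "\<dots> = t * (\<integral>\<omega>. g \<omega> \<partial>M) + d + prob B"
    using int assms(3) by (simp add: prob_space)
  finally show ?thesis .
qed

lemma measurable_cube_sum:
  assumes "random_probability_vector n M p"
  shows "(\<lambda>\<omega>. \<Sum>(i, j)\<in>vertex_pairs n. p \<omega> i j ^ 3) \<in> borel_measurable M"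
  using assms unfolding case_prod_unfold
  by (intro borel_measurable_sum borel_measurable_power)
    (auto simp: random_probability_vector_def)

section \<open>Asymptotic equivalence when the sum of cubes vanishes in probability\<close>

lemma asymptotically_equivalent_random_graph:
  fixes M :: "nat \<Rightarrow> 'a measure"
  assumes M: "\<And>n. prob_space (M n)"
    and p: "\<And>n. random_probability_vector n (M n) (p n)"
    and q: "\<And>n. random_probability_vector n (M n) (q n)"
    and K: "\<And>n. AE \<omega> in M n. \<forall>(i, j) \<in> vertex_pairs n.
           \<bar>q n \<omega> i j - p n \<omega> i j\<bar> \<le> K * (p n \<omega> i j)\<^sup>2"
    and small: "little_op_one M (\<lambda>n \<omega>. \<Sum>(i, j) \<in> vertex_pairs n. (p n \<omega> i j) ^ 3)"
  shows "asymptotically_equivalent (\<lambda>n. random_graph n (M n) (p n)) (\<lambda>n. random_graph n (M n) (q n))"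
  unfolding asymptotically_equivalent_def
proof (intro allI impI)
  fix A :: "nat \<Rightarrow> nat set set set"
  define S where "S n \<omega> = (\<Sum>(i, j) \<in> vertex_pairs n. (p n \<omega> i j) ^ 3)" for n \<omega>
  let ?P = "\<lambda>n \<omega>. measure (graph_pmf n (p n \<omega>)) (A n)"
  let ?Q = "\<lambda>n \<omega>. measure (graph_pmf n (q n \<omega>)) (A n)"
  let ?d = "\<lambda>n. measure (random_graph n (M n) (p n)) (A n) - measure (random_graph n (M n) (q n)) (A n)"
  \<comment> \<open>The restriction \<open>\<delta> \<le> 1/2\<close> supplies the bound 0.9 on the
    entries: each cube is at most the whole sum, and \<open>1/2 < 0.9^3\<close>.\<close>
  have bound: "\<bar>?d n\<bar> \<le> t + (exp (10 * K\<^sup>2 * \<delta>) - 1) / t + \<P>(\<omega> in M n. S n \<omega> > \<delta>)"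
    if t: "t > 0" and \<delta>: "0 < \<delta>" "\<delta> \<le> 1/2" for n t \<delta>
  proof -
    interpret prob_space "M n" by (rule M)
    have [measurable]: "S n \<in> borel_measurable (M n)"
      unfolding S_def by (rule measurable_cube_sum[OF p])
    have intP: "integrable (M n) (?P n)" and intQ: "integrable (M n) (?Q n)"
      by (rule integrable_measure_graph_pmf[OF M p] integrable_measure_graph_pmf[OF M q])+
    have "?d n = (\<integral>\<omega>. ?P n \<omega> - ?Q n \<omega> \<partial>M n)"
      using intP intQ by (simp add: measure_random_graph[OF M p] measure_random_graph[OF M q])
    then have "\<bar>?d n\<bar> \<le> (\<integral>\<omega>. \<bar>?P n \<omega> - ?Q n \<omega>\<bar> \<partial>M n)"
      by (simp add: integral_abs_bound)
    \<comment> \<open>The averaging lemma is used with \<open>g = 0\<close> and multiplier 1, the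
      whole bound being the additive constant.\<close>
    also have "\<dots> \<le> 1 * (\<integral>\<omega>. 0 \<partial>M n) + (t + (exp (10 * K\<^sup>2 * \<delta>) - 1) / t)
        + prob {\<omega> \<in> space (M n). S n \<omega> > \<delta>}"
    proof (rule integral_le_off_exceptional_set)
      show "integrable (M n) (\<lambda>\<omega>. \<bar>?P n \<omega> - ?Q n \<omega>\<bar>)"
        using intP intQ by auto
      show "\<bar>?P n \<omega> - ?Q n \<omega>\<bar> \<le> 1" for \<omega>
        using measure_pmf.prob_le_1[of "graph_pmf n (p n \<omega>)" "A n"]
          measure_pmf.prob_le_1[of "graph_pmf n (q n \<omega>)" "A n"]
        by (smt (verit) measure_nonneg)
      show "AE \<omega> in M n. \<omega> \<notin> {\<omega> \<in> space (M n). S n \<omega> > \<delta>} \<longrightarrow>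
          \<bar>?P n \<omega> - ?Q n \<omega>\<bar> \<le> 1 * 0 + (t + (exp (10 * K\<^sup>2 * \<delta>) - 1) / t)"
        using K[of n] AE_space
      proof eventually_elim
        case (elim \<omega>)
        show ?case
        proof
          assume "\<omega> \<notin> {\<omega> \<in> space (M n). S n \<omega> > \<delta>}"
          with elim have le: "S n \<omega> \<le> \<delta>"
            by auto
          have rng: "p n \<omega> i j \<in> {0..1}" "q n \<omega> i j \<in> {0..1}" if "(i, j) \<in> vertex_pairs n" for i j
            using p[of n] q[of n] that elim by (auto simp: random_probability_vector_def)
          have "p n \<omega> i j \<le> 0.9" if ij: "(i, j) \<in> vertex_pairs n" for i j
          proof (rule power_le_imp_le_base)
            have "p n \<omega> i j ^ 3 \<le> S n \<omega>"
              unfolding S_def using rng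
              by (intro order.trans[OF _ member_le_sum[OF ij]]) (auto simp: case_prod_unfold)
            also have "\<dots> \<le> 0.9 ^ 3"
              using le \<delta> by (simp add: power3_eq_cube)
            finally show "p n \<omega> i j ^ Suc 2 \<le> 0.9 ^ Suc 2"
              by (simp add: eval_nat_numeral)
          qed simp
          \<comment> \<open>The reference vector is \<open>p\<close> itself, so the comparison holds
            with \<open>c = 1\<close>.\<close>
          then have "\<bar>?Q n \<omega> - ?P n \<omega>\<bar> \<le> t + (exp (10 * K\<^sup>2 / 1 * \<delta>) - 1) / t"
            using elim rng le t
            by (intro graph_pmf_comparison(2)[where x = "p n \<omega>"]) (auto simp: S_def)
          then show "\<bar>?P n \<omega> - ?Q n \<omega>\<bar> \<le> 1 * 0 + (t + (exp (10 * K\<^sup>2 * \<delta>) - 1) / t)"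
            by (simp add: abs_minus_commute)
        qed
      qed
    qed (use t \<delta> in \<open>auto intro!: add_nonneg_nonneg divide_nonneg_pos\<close>)
    finally show ?thesis by simp
  qed
  show "?d \<longlonglongrightarrow> 0"
  proof (rule tendstoI)
    fix \<epsilon> :: real assume "\<epsilon> > 0"
    \<comment> \<open>Order of choices: first \<open>t\<close>, then \<open>\<delta>\<close> small
      enough for the exponential term to fall below \<open>t\<close>, and finally \<open>n\<close>
      large enough for the exceptional probability to do so.\<close>
    define t where "t = \<epsilon> / 3"
    have "t > 0" using \<open>\<epsilon> > 0\<close> by (simp add: t_def)
    have "((\<lambda>\<delta>. (exp (10 * K\<^sup>2 * \<delta>) - 1) / t) \<longlongrightarrow> (exp (10 * K\<^sup>2 * 0) - 1) / t) (at_right 0)"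
      by (intro tendsto_intros) (use \<open>t > 0\<close> in auto)
    then have "((\<lambda>\<delta>. (exp (10 * K\<^sup>2 * \<delta>) - 1) / t) \<longlongrightarrow> 0) (at_right 0)"
      by simp
    then have "\<forall>\<^sub>F \<delta> in at_right 0. (exp (10 * K\<^sup>2 * \<delta>) - 1) / t < t"
      using \<open>t > 0\<close> by (rule order_tendstoD(2))
    moreover have "\<forall>\<^sub>F \<delta> in at_right 0. \<delta> < (1 / 2 :: real)"
      by (rule order_tendstoD(2)[OF tendsto_ident_at]) simp
    moreover have "\<forall>\<^sub>F \<delta> in at_right 0. \<delta> > (0 :: real)"
      by (rule eventually_at_right_less)
    ultimately have "\<forall>\<^sub>F \<delta> in at_right 0. 0 < \<delta> \<and> \<delta> < 1 / 2 \<and> (exp (10 * K\<^sup>2 * \<delta>) - 1) / t < t"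
      by eventually_elim auto
    then obtain \<delta> where \<delta>: "0 < \<delta>" "\<delta> < 1 / 2" "(exp (10 * K\<^sup>2 * \<delta>) - 1) / t < t"
      using eventually_happens'[OF trivial_limit_at_right_real] by blast
    have "(\<lambda>n. \<P>(\<omega> in M n. S n \<omega> > \<delta>)) \<longlonglongrightarrow> 0"
      using small \<delta> by (simp add: little_op_one_def S_def)
    then have "\<forall>\<^sub>F n in sequentially. \<P>(\<omega> in M n. S n \<omega> > \<delta>) < t"
      using \<open>t > 0\<close> by (rule order_tendstoD(2))
    then show "\<forall>\<^sub>F n in sequentially. dist (?d n) 0 < \<epsilon>"
    proof eventually_elim
      case (elim n)
      moreover have "t + t + t = \<epsilon>"
        by (simp add: t_def)
      ultimately show ?case
        using bound[OF \<open>t > 0\<close> \<delta>(1), of n] \<delta> by (simp add: dist_real_def)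
    qed
  qed
qed

section \<open>Contiguity when the sum of cubes is bounded in probability\<close>

text \<open>The lemma is one-sided, with reference vector \<open>q\<close> and scale
  \<open>p\<close>, so that both directions of mutual contiguity are instances of it:
  \<open>q\<close> is \<open>p'\<close> in one and \<open>p\<close> in the other.\<close>

lemma contiguous_random_graph:
  fixes M :: "nat \<Rightarrow> 'a measure"
  assumes M: "\<And>n. prob_space (M n)"
    and p: "\<And>n. random_probability_vector n (M n) (p n)"
    and q: "\<And>n. random_probability_vector n (M n) (q n)"
    and q': "\<And>n. random_probability_vector n (M n) (q' n)"
    and K: "\<And>n. AE \<omega> in M n. \<forall>(i, j) \<in> vertex_pairs n.
           \<bar>q' n \<omega> i j - q n \<omega> i j\<bar> \<le> K * (p n \<omega> i j)\<^sup>2"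
    and bdd: "big_op_one M (\<lambda>n \<omega>. \<Sum>(i, j) \<in> vertex_pairs n. (p n \<omega> i j) ^ 3)"
    and c: "c > 0"
    and G: "\<And>n. {\<omega> \<in> space (M n). G n \<omega>} \<in> sets (M n)" "whp M G"
    and good: "\<And>n \<omega> i j. G n \<omega> \<Longrightarrow> (i, j) \<in> vertex_pairs n \<Longrightarrow> c * p n \<omega> i j \<le> q n \<omega> i j \<and> q n \<omega> i j \<le> 0.9"
  shows "contiguous (\<lambda>n. random_graph n (M n) (q' n)) (\<lambda>n. random_graph n (M n) (q n))"
  unfolding contiguous_def
proof (intro allI impI)
  fix A :: "nat \<Rightarrow> nat set set set"
  assume null: "(\<lambda>n. measure (random_graph n (M n) (q n)) (A n)) \<longlonglongrightarrow> 0"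
  define S where "S n \<omega> = (\<Sum>(i, j) \<in> vertex_pairs n. (p n \<omega> i j) ^ 3)" for n \<omega>
  let ?Q = "\<lambda>n. measure (random_graph n (M n) (q n)) (A n)"
  let ?Q' = "\<lambda>n. measure (random_graph n (M n) (q' n)) (A n)"
  have bound: "?Q' n \<le> t * ?Q n + exp (10 * K\<^sup>2 / c * C) / t
      + (\<P>(\<omega> in M n. S n \<omega> > C) + (1 - \<P>(\<omega> in M n. G n \<omega>)))" if t: "t > 0" for n t C
  proof -
    interpret prob_space "M n" by (rule M)
    have [measurable]: "S n \<in> borel_measurable (M n)"
      unfolding S_def by (rule measurable_cube_sum[OF p])
    \<comment> \<open>Off \<open>B\<close> the sum of cubes is at most \<open>C\<close> and the
      edgewise bounds hold, which is all the conditional comparison asks for.\<close>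
    define B where "B = {\<omega> \<in> space (M n). S n \<omega> > C} \<union> (space (M n) - {\<omega> \<in> space (M n). G n \<omega>})"
    have B: "B \<in> events"
      unfolding B_def using G(1) by measurable
    have "?Q' n \<le> t * ?Q n + exp (10 * K\<^sup>2 / c * C) / t + prob B"
      unfolding measure_random_graph[OF M q] measure_random_graph[OF M q']
    proof (rule integral_le_off_exceptional_set)
      show "AE \<omega> in M n. \<omega> \<notin> B \<longrightarrow> measure (graph_pmf n (q' n \<omega>)) (A n)
          \<le> t * measure (graph_pmf n (q n \<omega>)) (A n) + exp (10 * K\<^sup>2 / c * C) / t"
        using K[of n] AE_space
      proof eventually_elim
        case (elim \<omega>)
        show ?case
        proof
          assume "\<omega> \<notin> B"
          with elim have "S n \<omega> \<le> C" "G n \<omega>"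
            by (auto simp: B_def)
          moreover have "p n \<omega> i j \<in> {0..1}" "q n \<omega> i j \<in> {0..1}" "q' n \<omega> i j \<in> {0..1}"
            if "(i, j) \<in> vertex_pairs n" for i j
            using p[of n] q[of n] q'[of n] that elim by (auto simp: random_probability_vector_def)
          ultimately show "measure (graph_pmf n (q' n \<omega>)) (A n)
              \<le> t * measure (graph_pmf n (q n \<omega>)) (A n) + exp (10 * K\<^sup>2 / c * C) / t"
            using elim t c good[of n \<omega>]
            by (intro graph_pmf_comparison(1)[where x = "p n \<omega>"]) (auto simp: S_def)
        qed
      qed
    qed (use t B in \<open>auto intro: integrable_measure_graph_pmf[OF M] q q'\<close>)
    also have "prob B \<le> prob {\<omega> \<in> space (M n). S n \<omega> > C} + prob (space (M n) - {\<omega> \<in> space (M n). G n \<omega>})"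
      unfolding B_def by (intro measure_Un_le sets.Diff[OF sets.top G(1)]) measurable
    also have "prob (space (M n) - {\<omega> \<in> space (M n). G n \<omega>}) = 1 - prob {\<omega> \<in> space (M n). G n \<omega>}"
      by (rule prob_compl[OF G(1)])
    finally show ?thesis by simp
  qed
  show "?Q' \<longlonglongrightarrow> 0"
  proof (rule tendstoI)
    fix \<epsilon> :: real assume "\<epsilon> > 0"
    obtain C where C: "\<And>n. \<P>(\<omega> in M n. S n \<omega> > C) < \<epsilon> / 3"
      using bdd \<open>\<epsilon> > 0\<close> unfolding big_op_one_def S_def by (meson divide_pos_pos zero_less_numeral)
    \<comment> \<open>With \<open>C\<close> fixed uniformly in \<open>n\<close>, this
      \<open>t\<close> makes the second-moment term exactly \<open>\<epsilon> / 3\<close>. It does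
      not depend on \<open>n\<close>, so \<open>t * ?Q n\<close> still tends to 0.\<close>
    define t where "t = exp (10 * K\<^sup>2 / c * C) / (\<epsilon> / 3)"
    have t: "t > 0" "exp (10 * K\<^sup>2 / c * C) / t = \<epsilon> / 3"
      using \<open>\<epsilon> > 0\<close> by (auto simp: t_def)
    have "(\<lambda>n. t * ?Q n + (1 - \<P>(\<omega> in M n. G n \<omega>))) \<longlonglongrightarrow> t * 0 + (1 - 1)"
      using null G(2) unfolding whp_def by (intro tendsto_intros)
    then have "\<forall>\<^sub>F n in sequentially. t * ?Q n + (1 - \<P>(\<omega> in M n. G n \<omega>)) < \<epsilon> / 3"
      using \<open>\<epsilon> > 0\<close> by (intro order_tendstoD(2)[where a = "\<epsilon> / 3"]) auto
    then show "\<forall>\<^sub>F n in sequentially. dist (?Q' n) 0 < \<epsilon>"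
    proof eventually_elim
      case (elim n)
      then show ?case
        using bound[OF t(1), of n C] C[of n] t(2) by simp
    qed
  qed
qed

theorem corollary2p13:
  fixes M :: "nat \<Rightarrow> 'a measure"
    and p p' :: "nat \<Rightarrow> 'a \<Rightarrow> nat \<Rightarrow> nat \<Rightarrow> real"
  assumes "\<And>n. prob_space (M n)"
    and "\<And>n. random_probability_vector n (M n) (p n)"
    and "\<And>n. random_probability_vector n (M n) (p' n)"
    and "\<exists>K. \<forall>n. AE \<omega> in M n. \<forall>(i, j) \<in> vertex_pairs n.
           \<bar>p' n \<omega> i j - p n \<omega> i j\<bar> \<le> K * (p n \<omega> i j)\<^sup>2"
  shows "(little_op_one M (\<lambda>n \<omega>. \<Sum>(i, j) \<in> vertex_pairs n. (p n \<omega> i j) ^ 3) \<longrightarrow>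
            asymptotically_equivalent
              (\<lambda>n. random_graph n (M n) (p n)) (\<lambda>n. random_graph n (M n) (p' n))) \<and>
         (big_op_one M (\<lambda>n \<omega>. \<Sum>(i, j) \<in> vertex_pairs n. (p n \<omega> i j) ^ 3) \<and>
          (\<exists>c>0. whp M (\<lambda>n \<omega>. \<forall>(i, j) \<in> vertex_pairs n.
             p n \<omega> i j \<le> 0.9 \<and> p' n \<omega> i j \<le> 0.9 \<and> p' n \<omega> i j \<ge> c * p n \<omega> i j)) \<longrightarrow>
            contiguous
              (\<lambda>n. random_graph n (M n) (p n)) (\<lambda>n. random_graph n (M n) (p' n)) \<and>
            contiguous
              (\<lambda>n. random_graph n (M n) (p' n)) (\<lambda>n. random_graph n (M n) (p n)))"
proof (intro conjI impI)
  obtain K where K: "\<And>n. AE \<omega> in M n. \<forall>(i, j) \<in> vertex_pairs n.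
           \<bar>p' n \<omega> i j - p n \<omega> i j\<bar> \<le> K * (p n \<omega> i j)\<^sup>2"
    using assms(4) by blast
  let ?cubes = "\<lambda>n \<omega>. \<Sum>(i, j) \<in> vertex_pairs n. (p n \<omega> i j) ^ 3"
  let ?G = "\<lambda>c n \<omega>. \<forall>(i, j) \<in> vertex_pairs n.
             p n \<omega> i j \<le> 0.9 \<and> p' n \<omega> i j \<le> 0.9 \<and> p' n \<omega> i j \<ge> c * p n \<omega> i j"
  show "asymptotically_equivalent (\<lambda>n. random_graph n (M n) (p n)) (\<lambda>n. random_graph n (M n) (p' n))"
    if "little_op_one M ?cubes"
    using assms(1-3) K that by (rule asymptotically_equivalent_random_graph)
  assume "big_op_one M ?cubes \<and> (\<exists>c>0. whp M (?G c))"
  then obtain c where bdd: "big_op_one M ?cubes" and "c > 0" and whp: "whp M (?G c)"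
    by blast
  \<comment> \<open>The good event is a finite intersection over vertex pairs of measurable
    conditions.\<close>
  have G: "{\<omega> \<in> space (M n). ?G c n \<omega>} \<in> sets (M n)" for n
  proof -
    have [measurable]: "(\<lambda>\<omega>. p n \<omega> (fst e) (snd e)) \<in> borel_measurable (M n)"
      "(\<lambda>\<omega>. p' n \<omega> (fst e) (snd e)) \<in> borel_measurable (M n)" if "e \<in> vertex_pairs n" for e
      using assms(2,3)[of n] that by (auto simp: random_probability_vector_def)
    show ?thesis
      unfolding case_prod_unfold by (intro sets.sets_Collect_finite_All) auto
  qed
  have K': "AE \<omega> in M n. \<forall>(i, j) \<in> vertex_pairs n.
      \<bar>p n \<omega> i j - p' n \<omega> i j\<bar> \<le> K * (p n \<omega> i j)\<^sup>2" for n
    using K[of n] by (simp add: abs_minus_commute)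
  show "contiguous (\<lambda>n. random_graph n (M n) (p n)) (\<lambda>n. random_graph n (M n) (p' n))"
    \<comment> \<open>Reference vector \<open>p'\<close>: the condition \<open>c * p <= p'\<close>
      of the good event controls the denominators.\<close>
    by (rule contiguous_random_graph[OF assms(1,2,3,2) K' bdd \<open>c > 0\<close> G whp]) auto
  show "contiguous (\<lambda>n. random_graph n (M n) (p' n)) (\<lambda>n. random_graph n (M n) (p n))"
    \<comment> \<open>Reference vector \<open>p\<close>: the lower bound is trivial with constant 1,
      and the good event supplies \<open>p <= 0.9\<close>.\<close>
    by (rule contiguous_random_graph[OF assms(1,2,2,3) K bdd zero_less_one G whp]) auto
qed

end
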